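(* Let $k\geq 3$ and $\mathbf{x}=(x_1,\ldots,x_n)\in\Delta^{n-1}$, and let $\sigma=\sigma(\mathbf{x})$. If $|\mathbf{x}|_{\max}\leq 1/(4(k-2))$, then \[ S_k(\mathbf{x})<\sigma^k\binom{1/\sigma}{k}, \] unless the nonzero entries of $\mathbf{x}$ are equal.
   Context: $\Delta^{n-1}=\{\mathbf{x}\in\mathbb{R}^n: x_i\geq0 \text{ for all } i,\ \sum_i x_i=1\}$. $S_k(\mathbf{x})$ denotes the $k$-th elementary symmetric polynomial of $x_1,\ldots,x_n$. $\sigma(\mathbf{x})=x_1^{x_1}\cdots x_n^{x_n}$, with the convention $0^0=1$. $|\mathbf{x}|_{\max}=\max_i x_i$. For real $s$, $\binom{s}{k}=s(s-1)\cdots(s-k+1)/k!$, so that $\sigma^k\binom{1/\sigma}{k}=\frac{1}{k!}(1-\sigma)(1-2\sigma)\cdots(1-(k-1)\sigma)$. *)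

theory Defs
  imports Complex_Main
begin

definition simplex :: "nat \<Rightarrow> (nat \<Rightarrow> real) set" where
  "simplex n = {x. (\<forall>i<n. 0 \<le> x i) \<and> (\<Sum>i<n. x i) = 1}"

definition elem_sym :: "nat \<Rightarrow> nat \<Rightarrow> (nat \<Rightarrow> real) \<Rightarrow> real" where
  "elem_sym n k x = (\<Sum>I\<in>{I. I \<subseteq> {..<n} \<and> card I = k}. \<Prod>i\<in>I. x i)"

text \<open>sigma(x) = prod x_i^x_i with the convention 0^0 = 1.\<close>
definition sigma_ent :: "nat \<Rightarrow> (nat \<Rightarrow> real) \<Rightarrow> real" where
  "sigma_ent n x = (\<Prod>i<n. if x i = 0 then 1 else x i powr x i)"

definition max_norm :: "nat \<Rightarrow> (nat \<Rightarrow> real) \<Rightarrow> real" where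
  "max_norm n x = Max {x i | i. i < n}"

end

theory Submission
  imports Defs "HOL-Analysis.Convex"
begin

text \<open>
  Sampling without repetition gives \<open>k S\<^sub>k(x) = \<Sum>\<^sub>i x\<^sub>i S\<^bsub>k-1\<^esub>(x without x\<^sub>i)\<close>, which suggests induction
  on \<open>k\<close> for the homogeneous inequality
  \<open>k! S\<^sub>k \<le> s \<Prod>\<^bsub>1\<le>j<k\<^esub> (s - j T)\<close> with \<open>s = \<Sum>\<^sub>i x\<^sub>i\<close> and \<open>T = exp (\<Sum>\<^sub>i x\<^sub>i ln x\<^sub>i / s)\<close>;
  the bound \<open>4 (k - 2) x\<^sub>i \<le> s\<close> is inherited by the smaller families.
  The sum and the \<open>T\<close> of the family without \<open>x\<^sub>i\<close> depend on \<open>s\<close>, \<open>T\<close> and \<open>x\<^sub>i\<close> only, so the induction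
  hypothesis turns into a function \<open>F(x\<^sub>i)\<close>. This function lies below its tangent line at \<open>T\<close> in the
  variable \<open>ln x\<close>, strictly away from \<open>T\<close>, and since \<open>\<Sum>\<^sub>i x\<^sub>i ln (x\<^sub>i / T) = 0\<close>, averaging the tangent
  line gives \<open>F(T)\<close>, the desired product. For \<open>s = 1\<close> the tangent line bound follows by applying the
  AM-GM inequality to the ratios of the factors of \<open>F(x)\<close> and \<open>F(T)\<close>, whose logarithmic derivatives
  at \<open>T\<close> all agree.
\<close>

section \<open>Elementary estimates for the logarithm\<close>

lemma ln_le_half_diff_inverse:
  fixes u :: real
  assumes "1 \<le> u"
  shows "2 * ln u \<le> u - 1 / u"
proof -
  have "(\<lambda>u. u - 1 / u - 2 * ln u) 1 \<le> (\<lambda>u. u - 1 / u - 2 * ln u) u"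
  proof (rule DERIV_nonneg_imp_nondecreasing[OF assms])
    fix t :: real
    assume t: "1 \<le> t" "t \<le> u"
    have "((\<lambda>u. u - 1 / u - 2 * ln u) has_real_derivative (1 - 1 / t)\<^sup>2) (at t)"
      using t by (auto intro!: derivative_eq_intros simp: power2_eq_square field_simps)
    then show "\<exists>y. ((\<lambda>u. u - 1 / u - 2 * ln u) has_real_derivative y) (at t) \<and> 0 \<le> y"
      by (metis zero_le_power2)
  qed
  then show ?thesis by simp
qed

text \<open>Truncated Taylor series; it yields the lower bound \<open>\<rho>\<close> for
  \<open>r / w^2\<close> in \<open>log_remainder_bound\<close>.\<close>

lemma minus_ln_one_minus_ge:
  fixes w :: real
  assumes "0 \<le> w" "w < 1"
  shows "w + w^2 / 2 + w^3 / 3 + w^4 / 4 + w^5 / 5 \<le> - ln (1 - w)"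
proof -
  let ?f = "\<lambda>w::real. - ln (1 - w) - (w + w^2 / 2 + w^3 / 3 + w^4 / 4 + w^5 / 5)"
  have "?f 0 \<le> ?f w"
  proof (rule DERIV_nonneg_imp_nondecreasing[OF assms(1)])
    fix t :: real
    assume t: "0 \<le> t" "t \<le> w"
    have "(?f has_real_derivative 1 / (1 - t) - (1 + t + t^2 + t^3 + t^4)) (at t)"
      using t assms by (auto intro!: derivative_eq_intros simp: field_simps)
    moreover have "1 / (1 - t) - (1 + t + t^2 + t^3 + t^4) = t^5 / (1 - t)"
      using t assms by (simp add: field_simps eval_nat_numeral)
    moreover have "0 \<le> t^5 / (1 - t)"
      using t assms by simp
    ultimately show "\<exists>y. (?f has_real_derivative y) (at t) \<and> 0 \<le> y"
      by (intro exI[of _ "t^5 / (1 - t)"]) simp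
  qed
  then show ?thesis by simp
qed

lemma remainder_polynomial_identity:
  fixes w :: real
  defines "\<rho> \<equiv> 1/2 + w/3 + w^2/4 + w^3/5"
  defines "q \<equiv> 5/12 * (1/2 + w/6 + w^2/12 + w^3/20 + w^4/5)"
  shows "(\<rho> - q) * (4 - w - w\<^sup>2 * q) - (1 + w * q)\<^sup>2 =
      1/6 + 25/72 * w + 17/48 * w^2 + 59/180 * w^3 - 1397/2160 * w^4 - 71/432 * w^5
      - 41/576 * w^6 - 23/576 * w^7 - 1/40 * w^8 - 1/60 * w^9"
  unfolding assms
  by (simp add: field_simps power2_eq_square power_add[symmetric] power_Suc[symmetric] power_numeral_reduce)

text \<open>The case \<open>x < \<sigma>\<close> of \<open>remainder_gt\<close>, with
  \<open>w = 1 - x / \<sigma>\<close>. Since \<open>r\<close> enters the bound on \<open>p\<close>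
  negatively, one lower bound on \<open>r\<close> controls both quantities.\<close>

lemma log_remainder_bound:
  fixes w r p :: real
  assumes w: "0 < w" "w < 1"
    and r: "r = - w - ln (1 - w)"
    and p: "0 \<le> p" "p \<le> 5 / 12 * (w\<^sup>2 - (1 - w) * r)"
  shows "p \<le> w" and "(w + p)\<^sup>2 < (r - p) * (4 - (w + p))" and "p \<le> r"
proof -
  \<comment> \<open>By Taylor \<open>w\<^sup>2 * \<rho> \<le> r\<close>, and inserting this into the
    bound on \<open>p\<close> gives \<open>p \<le> w\<^sup>2 * q\<close>. Division by
    \<open>w\<^sup>2\<close> then reduces the second claim to the inequality
    \<open>poly\<close>.\<close>
  define \<rho> where "\<rho> = 1/2 + w/3 + w^2/4 + w^3/5"
  define q where "q = 5 / 12 * (1 - (1 - w) * \<rho>)"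
  have r_ge: "w\<^sup>2 * \<rho> \<le> r"
    using minus_ln_one_minus_ge[of w] w by (simp add: r \<rho>_def algebra_simps eval_nat_numeral)
  have q_eq: "q = 5/12 * (1/2 + w/6 + w^2/12 + w^3/20 + w^4/5)"
    by (simp add: q_def \<rho>_def field_simps eval_nat_numeral)
  have "w^2 \<le> 1" "w^3 \<le> 1" "w^4 \<le> 1"
    using w by (simp_all add: power_le_one)
  then have q: "0 \<le> q" "q \<le> 5/12"
    using w unfolding q_eq by auto
  have p_le: "p \<le> w\<^sup>2 * q"
  proof -
    have "(1 - w) * (w\<^sup>2 * \<rho>) \<le> (1 - w) * r"
      using r_ge w by (intro mult_left_mono) auto
    with p show ?thesis by (simp add: q_def algebra_simps)
  qed
  have w2: "w\<^sup>2 \<le> w"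
    using w by (simp add: power2_eq_square)
  have wq: "w\<^sup>2 * q \<le> w * (5/12)"
    using q w2 w by (intro mult_mono) auto
  show "p \<le> w" using p_le wq w by linarith
  have poly: "(1 + w * q)\<^sup>2 < (\<rho> - q) * (4 - w - w\<^sup>2 * q)"
  proof -
    have "(\<rho> - q) * (4 - w - w\<^sup>2 * q) - (1 + w * q)\<^sup>2 =
        1/6 + 25/72 * w + 17/48 * w^2 + 59/180 * w^3 - 1397/2160 * w^4 - 71/432 * w^5
        - 41/576 * w^6 - 23/576 * w^7 - 1/40 * w^8 - 1/60 * w^9"
      unfolding q_eq \<rho>_def by (rule remainder_polynomial_identity)
    \<comment> \<open>Only the terms of degree at least four are negative. Their coefficients sum to
      less than 0.97 in absolute value, those of \<open>w\<close>, \<open>w^2\<close>,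
      \<open>w^3\<close> to more than 1.02, and each of these powers is at least
      \<open>w^4\<close>.\<close>
    moreover have "w^4 \<le> w"
      using w power_decreasing[of 1 4 w] by simp
    moreover have "w^4 \<le> w^2" "w^4 \<le> w^3" "w^5 \<le> w^4" "w^6 \<le> w^4" "w^7 \<le> w^4" "w^8 \<le> w^4" "w^9 \<le> w^4"
      using w by (auto intro!: power_decreasing)
    moreover have "0 \<le> w^4" using w by simp
    ultimately show ?thesis by linarith
  qed
  have "\<rho> - q > 0"
    using w q zero_le_power[of w 2] zero_le_power[of w 3] unfolding \<rho>_def by linarith
  have pos: "0 < w\<^sup>2 * (\<rho> - q)"
    using \<open>\<rho> - q > 0\<close> w by simp
  have le: "w\<^sup>2 * (\<rho> - q) \<le> r - p"
    using r_ge p_le by (simp add: algebra_simps)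
  show "p \<le> r" using pos le by linarith
  have "(w + p)\<^sup>2 \<le> (w * (1 + w * q))\<^sup>2"
    using p_le p w by (intro power_mono) (auto simp: algebra_simps power2_eq_square)
  also have "\<dots> = w\<^sup>2 * (1 + w * q)\<^sup>2"
    by (simp add: power_mult_distrib)
  also have "\<dots> < w\<^sup>2 * ((\<rho> - q) * (4 - w - w\<^sup>2 * q))"
    using poly w by simp
  also have "\<dots> = w\<^sup>2 * (\<rho> - q) * (4 - w - w\<^sup>2 * q)"
    by simp
  also have "\<dots> \<le> (r - p) * (4 - (w + p))"
    using pos le p_le wq w by (intro mult_mono) auto
  finally show "(w + p)\<^sup>2 < (r - p) * (4 - (w + p))" .
qed

section \<open>A power against the tangent line in one variable\<close>

text \<open>Bernoulli applied to \<open>1 / (1 + z)\<close>, which gives an error term that is exact for \<open>m = 1\<close>.\<close>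
lemma power_Suc_one_plus_le:
  fixes z :: real
  assumes "-1 < z" and "(real m - 1) * z < 1" and m: "1 \<le> m"
  shows "(1 + z) ^ (m + 1) \<le> 1 + (real m + 1) * z + (real m * z)\<^sup>2 / (1 - (real m - 1) * z)"
proof -
  let ?v = "- z / (1 + z)"
  have "1 + real m * ?v \<le> (1 + ?v) ^ m"
    using assms by (intro Bernoulli_inequality) (simp add: field_simps)
  moreover have "1 + real m * ?v = (1 - (real m - 1) * z) / (1 + z)"
    and "1 + ?v = 1 / (1 + z)"
    using assms by (simp_all add: field_simps)
  ultimately have "(1 - (real m - 1) * z) / (1 + z) \<le> 1 / (1 + z) ^ m"
    by (simp add: power_one_over)
  then have "(1 - (real m - 1) * z) * (1 + z) ^ m \<le> 1 + z"
    using assms by (simp add: field_simps)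
  then have "(1 + z) ^ m \<le> (1 + z) / (1 - (real m - 1) * z)"
    using assms by (simp add: field_simps)
  then have "(1 + z) * (1 + z) ^ m \<le> (1 + z) * ((1 + z) / (1 - (real m - 1) * z))"
    using assms by (intro mult_left_mono) auto
  also have "\<dots> = 1 + (real m + 1) * z + (real m * z)\<^sup>2 / (1 - (real m - 1) * z)"
    using assms by (simp add: field_simps power2_eq_square)
  finally show ?thesis by simp
qed

lemma le_quarter:
  fixes m y :: real
  assumes "1 \<le> m" "0 < y" "4 * m * y \<le> 1"
  shows "y \<le> 1 / 4"
  using assms mult_right_mono[of 1 m y] by linarith

lemma xlog_ge:
  fixes u :: real
  assumes "0 < u"
  shows "u - 1 \<le> u * ln u"
proof -
  have "1 - 1 / u \<le> ln u"
    using ln_le_minus_one[of "1 / u"] assms by (simp add: ln_div)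
  then have "u * (1 - 1 / u) \<le> u * ln u"
    using assms by (intro mult_left_mono) auto
  then show ?thesis using assms by (simp add: right_diff_distrib)
qed

text \<open>Here \<open>u = x / \<sigma>\<close>, the remainders \<open>\<sigma> r\<close> and \<open>\<sigma> (u ln u - u + 1)\<close> are those of the tangent lines at \<open>\<sigma>\<close>
  of \<open>ln\<close> and \<open>x ln x\<close> (up to scaling), and \<open>(1 - \<sigma>) z = \<sigma> - x + \<sigma> p\<close>.\<close>
lemma remainder_gt:
  fixes u \<sigma> :: real
  assumes m: "1 \<le> (m::real)" and \<sigma>: "0 < \<sigma>" "4 * m * \<sigma> \<le> 1" and u: "0 < u" "4 * m * (\<sigma> * u) \<le> 1" "u \<noteq> 1"
    and r: "r = u - 1 - ln u"
    and p: "p = m * \<sigma> * (u * ln u - u + 1 + \<sigma> * u * r) / (1 - \<sigma> * u)"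
    and z: "z = \<sigma> * (1 - u + p) / (1 - \<sigma>)"
  shows "-1 < z" and "(m - 1) * z < 1"
    and "(m * z)\<^sup>2 / (1 - (m - 1) * z) < (m + 1) * \<sigma> * (r - p) / (1 - \<sigma>)"
proof -
  have \<sigma>4: "\<sigma> \<le> 1 / 4" and x4: "\<sigma> * u \<le> 1 / 4"
    using le_quarter m \<sigma> u(1,2) by (metis mult_pos_pos)+
  have xpos: "0 < \<sigma> * u" using \<sigma> u by simp
  have r0: "0 \<le> r" using ln_le_minus_one[of u] u r by simp
  have r20: "0 \<le> u * ln u - u + 1" using xlog_ge[of u] u by simp
  have "0 \<le> u * ln u - u + 1 + \<sigma> * u * r"
    using r0 \<sigma> u by (intro add_nonneg_nonneg[OF r20] mult_nonneg_nonneg) auto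
  then have p0: "0 \<le> p"
    unfolding p using m \<sigma> x4 by (intro divide_nonneg_pos mult_nonneg_nonneg) auto
  have m\<sigma>: "m \<le> (m + 1) * (1 - \<sigma>)"
    using \<sigma> \<sigma>4 m by (simp add: algebra_simps)
  \<comment> \<open>The last conjunct is the third claim cleared of denominators, with
    \<open>(m + 1) * (1 - \<sigma>)\<close> replaced by its lower bound \<open>m\<close>.\<close>
  have "-1 < z \<and> (m - 1) * z < 1 \<and> p \<le> r \<and> m\<^sup>2 * \<sigma> * (1 - u + p)\<^sup>2 < m * (r - p) * (1 - (m - 1) * z)"
  proof (cases "u < 1")
    case True
    define w where "w = 1 - u"
    have w: "0 < w" "w < 1" and u_eq: "u = 1 - w" using True u by (auto simp: w_def)
    have r_eq: "r = - w - ln (1 - w)" by (simp add: r w_def)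
    have r2: "u * ln u - u + 1 = w\<^sup>2 - (1 - w) * r"
      by (simp add: r_eq u_eq power2_eq_square algebra_simps)
    have "2 * ln (1 / u) \<le> 1 / u - u"
      using ln_le_half_diff_inverse[of "1 / u"] True u by simp
    then have "u * (2 * ln (1 / u)) \<le> u * (1 / u - u)"
      using u by (intro mult_left_mono) auto
    then have ur: "u * r \<le> u * ln u - u + 1"
      using u by (simp add: r ln_div algebra_simps)
    have "u * \<sigma> \<le> \<sigma>" using True \<sigma> by (simp add: mult_le_cancel_right1)
    \<comment> \<open>Here \<open>m * \<sigma>\<close>, \<open>\<sigma>\<close> and
      \<open>\<sigma> * u\<close> are each at most 1/4, whence the constant
      \<open>5/12 = (1/4) * (5/4) / (3/4)\<close>.\<close>
    have "p \<le> (1 / 4) * ((1 + 1/4) * (u * ln u - u + 1)) / (1 - 1 / 4)"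
      unfolding p
    proof (intro frac_le mult_mono)
      have "\<sigma> * (u * r) \<le> 1/4 * (u * ln u - u + 1)"
        using ur \<sigma> \<sigma>4 r0 u by (intro mult_mono) auto
      then show "u * ln u - u + 1 + \<sigma> * u * r \<le> (1 + 1/4) * (u * ln u - u + 1)"
        by (simp add: algebra_simps)
    qed (use m \<sigma> x4 xpos r0 r20 in auto)
    then have ple: "p \<le> 5 / 12 * (w\<^sup>2 - (1 - w) * r)"
      unfolding r2 by simp
    note bd = log_remainder_bound[OF w r_eq p0 ple]
    have zpos: "0 < z" unfolding z using \<sigma> \<sigma>4 w p0 by (auto simp: w_def intro!: divide_pos_pos mult_pos_pos)
    have "(m - 1) * \<sigma> / (1 - \<sigma>) \<le> 1 / 4"
      using \<sigma> \<sigma>4 by (simp add: field_simps)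
    then have "(m - 1) * \<sigma> / (1 - \<sigma>) * (w + p) \<le> 1 / 4 * (w + p)"
      using w p0 by (intro mult_right_mono) auto
    then have mz: "(m - 1) * z \<le> (w + p) / 4"
      by (simp add: z w_def mult.assoc)
    have "m\<^sup>2 * \<sigma> * (w + p)\<^sup>2 = m * ((m * \<sigma>) * (w + p)\<^sup>2)" by (simp add: power2_eq_square)
    also have "\<dots> \<le> m * (1 / 4 * (w + p)\<^sup>2)"
      using m \<sigma> by (intro mult_left_mono mult_right_mono) auto
    also have "\<dots> < m * ((r - p) * (1 - (w + p) / 4))"
      using bd(2) m by (intro mult_strict_left_mono) (auto simp: right_diff_distrib)
    also have "\<dots> \<le> m * ((r - p) * (1 - (m - 1) * z))"
      using bd(3) m mz by (intro mult_left_mono) auto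
    finally show ?thesis
      using zpos mz bd w by (simp add: w_def mult.assoc)
  next
    case False
    with u have u1: "1 < u" by simp
    have half: "(u - 1)\<^sup>2 / (2 * u) \<le> r"
      using ln_le_half_diff_inverse[of u] u1 by (simp add: r field_simps power2_eq_square)
    have "u * ln u - u + 1 \<le> u * r"
    proof -
      have "u * (2 * ln u) \<le> u * (u - 1 / u)"
        using ln_le_half_diff_inverse[of u] u1 by (intro mult_left_mono) auto
      then show ?thesis using u1 by (simp add: r algebra_simps)
    qed
    then have "u * ln u - u + 1 + \<sigma> * u * r \<le> (1 + 1/4) * (u * r)"
      using mult_right_mono[OF \<sigma>4, of "u * r"] r0 u by (simp add: algebra_simps)
    \<comment> \<open>For \<open>u > 1\<close> the factor \<open>u\<close> is absorbed by
      \<open>m * (\<sigma> * u) \<le> 1/4\<close>, so 5/12 appears again, now relative to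
      \<open>r\<close>.\<close>
    then have "m * \<sigma> * (u * ln u - u + 1 + \<sigma> * u * r) \<le> m * \<sigma> * ((1 + 1/4) * (u * r))"
      using m \<sigma> by (intro mult_left_mono) auto
    also have "\<dots> = (m * (\<sigma> * u)) * ((1 + 1/4) * r)" by simp
    also have "\<dots> \<le> 1 / 4 * ((1 + 1/4) * r)"
      using u r0 by (intro mult_right_mono) auto
    finally have "p \<le> (1 / 4 * ((1 + 1/4) * r)) / (1 - 1/4)"
      unfolding p using x4 r0 by (intro frac_le) auto
    then have ple: "p \<le> 5 / 12 * r" by simp
    have "r \<le> u - 1" using u1 by (simp add: r)
    have up: "0 < u - 1 - p" using ple \<open>r \<le> u - 1\<close> r0 u1 by linarith
    have "z < 0" unfolding z using up \<sigma> \<sigma>4 by (intro divide_neg_pos mult_pos_neg) auto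
    have "\<sigma> * (u - 1 - p) < 1 - \<sigma>"
    proof -
      have "\<sigma> * (u - 1 - p) \<le> \<sigma> * u" using \<sigma> p0 by (intro mult_left_mono) auto
      then show ?thesis using x4 \<sigma>4 by linarith
    qed
    then have z1: "-1 < z"
      unfolding z using \<sigma>4 by (simp add: field_simps)
    have mz: "(m - 1) * z \<le> 0" using m \<open>z < 0\<close> by (simp add: mult_nonneg_nonpos)
    have rpos: "0 < r" using half u1 by (smt (verit) divide_pos_pos zero_less_power)
    have "(1 - u + p)\<^sup>2 = (u - 1 - p)\<^sup>2" by (simp add: power2_eq_square algebra_simps)
    also have "\<dots> \<le> (u - 1)\<^sup>2" using up p0 by (intro power_mono) auto
    also have "\<dots> \<le> 2 * u * r" using half u1 by (simp add: field_simps)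
    finally have "m\<^sup>2 * \<sigma> * (1 - u + p)\<^sup>2 \<le> m\<^sup>2 * \<sigma> * (2 * u * r)"
      using \<sigma> by (intro mult_left_mono) auto
    also have "\<dots> = m * (2 * (m * (\<sigma> * u)) * r)" by (simp add: power2_eq_square)
    also have "\<dots> \<le> m * (2 * (1 / 4) * r)"
      using m u r0 by (intro mult_left_mono mult_right_mono) auto
    \<comment> \<open>From \<open>p \<le> 5/12 * r\<close> at least \<open>7/12 * r\<close> is left,
      more than the \<open>1/2 * r\<close> needed.\<close>
    also have "\<dots> < m * (r - p)" using ple rpos m by simp
    also have "\<dots> \<le> m * (r - p) * (1 - (m - 1) * z)"
      using mult_left_mono[of 1 "1 - (m - 1) * z" "m * (r - p)"] mz m ple r0 by simp
    finally show ?thesis using z1 mz ple r0 by auto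
  qed
  then have *: "-1 < z" "(m - 1) * z < 1" "p \<le> r" "m\<^sup>2 * \<sigma> * (1 - u + p)\<^sup>2 < m * (r - p) * (1 - (m - 1) * z)"
    by auto
  show "-1 < z" "(m - 1) * z < 1" by fact+
  have "m\<^sup>2 * \<sigma> * (1 - u + p)\<^sup>2 < ((m + 1) * (1 - \<sigma>)) * (r - p) * (1 - (m - 1) * z)"
    using *(4)
  proof (rule less_le_trans)
    show "m * (r - p) * (1 - (m - 1) * z) \<le> ((m + 1) * (1 - \<sigma>)) * (r - p) * (1 - (m - 1) * z)"
      using m\<sigma> * by (intro mult_right_mono) auto
  qed
  then have "\<sigma> / (1 - \<sigma>)\<^sup>2 * (m\<^sup>2 * \<sigma> * (1 - u + p)\<^sup>2) < \<sigma> / (1 - \<sigma>)\<^sup>2 * (((m + 1) * (1 - \<sigma>)) * (r - p) * (1 - (m - 1) * z))"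
    using \<sigma> \<sigma>4 by (intro mult_strict_left_mono) auto
  then have "(m * z)\<^sup>2 < (m + 1) * \<sigma> * (r - p) / (1 - \<sigma>) * (1 - (m - 1) * z)"
    using \<sigma>4 unfolding z by (simp add: power_mult_distrib power_divide power2_eq_square mult_ac)
  then show "(m * z)\<^sup>2 / (1 - (m - 1) * z) < (m + 1) * \<sigma> * (r - p) / (1 - \<sigma>)"
    using *(2) by (simp add: pos_divide_less_eq)
qed

text \<open>If the base on the left is \<open>1 + z\<close>, then the right side exceeds
  \<open>1 + (m + 1) * z\<close> by exactly
  \<open>(m + 1) * \<sigma> * (r - p) / (1 - \<sigma>)\<close>. By \<open>remainder_gt\<close> this
  beats the error term of \<open>power_Suc_one_plus_le\<close>.\<close>

lemma power_lt_linear_log: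
  fixes x \<sigma> :: real
  defines "D \<equiv> x * ln (x / \<sigma>) / (1 - x) - (x - \<sigma>) / (1 - \<sigma>)"
  assumes m: "1 \<le> m" and \<sigma>: "0 < \<sigma>" "4 * real m * \<sigma> \<le> 1" and x: "0 < x" "4 * real m * x \<le> 1" "x \<noteq> \<sigma>"
  shows "(1 + ((\<sigma> - x) / (1 - \<sigma>) + real m * \<sigma> * D)) ^ (m + 1)
      < 1 - (real m + 1) * \<sigma> * ln (x / \<sigma>) / (1 - \<sigma>)"
proof -
  define u where "u = x / \<sigma>"
  define r where "r = u - 1 - ln u"
  define p where "p = real m * \<sigma> * (u * ln u - u + 1 + \<sigma> * u * r) / (1 - \<sigma> * u)"
  define z where "z = \<sigma> * (1 - u + p) / (1 - \<sigma>)"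
  have x_eq: "x = \<sigma> * u" using \<sigma> by (simp add: u_def)
  have \<sigma>4: "\<sigma> \<le> 1 / 4" and x4: "x \<le> 1 / 4"
    using le_quarter[of "real m"] m \<sigma> x(1,2) by (metis of_nat_1 of_nat_mono)+
  have u: "0 < u" "4 * real m * (\<sigma> * u) \<le> 1" "u \<noteq> 1" using x \<sigma> by (auto simp: u_def)
  note rg = remainder_gt[OF _ \<sigma> u r_def p_def z_def]
  have D_eq: "D = (u * ln u - u + 1 + \<sigma> * u * r) / (1 - \<sigma> * u) * (\<sigma> / (1 - \<sigma>))"
    using \<sigma> \<sigma>4 x4 unfolding D_def x_eq r_def by (simp add: divide_simps) (simp add: algebra_simps)
  have "z = \<sigma> * (1 - u) / (1 - \<sigma>) + p * (\<sigma> / (1 - \<sigma>))"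
    by (simp add: z_def add_divide_distrib distrib_left)
  also have "\<dots> = (\<sigma> - x) / (1 - \<sigma>) + real m * \<sigma> * D"
    unfolding D_eq p_def x_eq by (simp add: right_diff_distrib)
  finally have z_eq: "(\<sigma> - x) / (1 - \<sigma>) + real m * \<sigma> * D = z" ..
  have "(1 + z) ^ (m + 1) \<le> 1 + (real m + 1) * z + (real m * z)\<^sup>2 / (1 - (real m - 1) * z)"
    using rg m by (intro power_Suc_one_plus_le) auto
  also have "\<dots> < 1 + (real m + 1) * z + (real m + 1) * \<sigma> * (r - p) / (1 - \<sigma>)"
    using rg m by simp
  also have "\<dots> = 1 - (real m + 1) * \<sigma> * ln (x / \<sigma>) / (1 - \<sigma>)"
    using \<sigma>4 unfolding z_def r_def u_def by (simp add: divide_simps) (simp add: algebra_simps)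
  finally show ?thesis unfolding z_eq .
qed

section \<open>AM-GM and the tangent line bound for products\<close>

lemma prod_le_power_mean:
  fixes a :: "'a \<Rightarrow> real"
  assumes "finite S" "S \<noteq> {}" "\<And>i. i \<in> S \<Longrightarrow> 0 \<le> a i"
  shows "(\<Prod>i\<in>S. a i) \<le> ((\<Sum>i\<in>S. a i) / card S) ^ card S"
proof -
  have card: "0 < card S" using assms by (simp add: card_gt_0_iff)
  have "0 \<le> (\<Prod>i\<in>S. a i)" using assms by (simp add: prod_nonneg)
  then have "(\<Prod>i\<in>S. a i) = ((\<Prod>i\<in>S. a i) powr (1 / card S)) ^ card S"
    using card by (cases "(\<Prod>i\<in>S. a i) = 0") (simp_all add: powr_power)
  also have "\<dots> \<le> ((\<Sum>i\<in>S. a i) / card S) ^ card S"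
    using arith_geom_mean[OF assms] by (intro power_mono) (simp_all add: sum_divide_distrib)
  finally show ?thesis .
qed

text \<open>\<open>\<tau>\<close> is the weighted geometric mean that remains when an entry
  \<open>x\<close> leaves a family with sum 1 and mean \<open>\<sigma>\<close>. The right side is
  the tangent line of the left side at \<open>\<sigma>\<close>, in the variable
  \<open>ln x\<close>.\<close>

lemma prod_normalised_le:
  fixes x \<sigma> :: real and m :: nat
  defines "\<tau> \<equiv> \<sigma> * exp (- (x * ln (x / \<sigma>) / (1 - x)))"
  assumes m: "1 \<le> m" and \<sigma>: "0 < \<sigma>" "4 * real m * \<sigma> \<le> 1" and x: "0 < x" "4 * real m * x \<le> 1"
  shows "(\<Prod>j\<le>m. 1 - x - real j * \<tau>)
      \<le> (\<Prod>j\<le>m. 1 - (real j + 1) * \<sigma>) * (1 - (real m + 1) * \<sigma> * ln (x / \<sigma>) / (1 - \<sigma>))" (is "?L \<le> ?R")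
    and "x \<noteq> \<sigma> \<Longrightarrow> (\<Prod>j\<le>m. 1 - x - real j * \<tau>)
      < (\<Prod>j\<le>m. 1 - (real j + 1) * \<sigma>) * (1 - (real m + 1) * \<sigma> * ln (x / \<sigma>) / (1 - \<sigma>))"
proof -
  define y where "y = x * ln (x / \<sigma>) / (1 - x)"
  \<comment> \<open>The excess of \<open>y\<close>, as a function of \<open>x\<close>, over its
    tangent line at \<open>\<sigma>\<close>.\<close>
  define D where "D = y - (x - \<sigma>) / (1 - \<sigma>)"
  \<comment> \<open>\<open>g j\<close> is the factor at \<open>x = \<sigma>\<close>, where
    \<open>\<tau> = \<sigma>\<close>, and \<open>a j\<close> bounds the ratio to it. The first-order
    part of \<open>a j\<close> is the same for all \<open>j\<close>; the 2 in front of
    \<open>D\<close> makes up for \<open>g j \<ge> 1/2\<close>.\<close>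
  define g where "g j = 1 - (real j + 1) * \<sigma>" for j
  define a where "a j = 1 + (\<sigma> - x) / (1 - \<sigma>) + 2 * real j * \<sigma> * D" for j
  have \<sigma>4: "\<sigma> \<le> 1 / 4" and x4: "x \<le> 1 / 4"
    using le_quarter[of "real m"] m \<sigma> x by (metis of_nat_1 of_nat_mono)+
  have D0: "0 \<le> D"
  proof -
    have "\<sigma> * (x / \<sigma> - 1) \<le> \<sigma> * (x / \<sigma> * ln (x / \<sigma>))"
      using xlog_ge[of "x / \<sigma>"] x \<sigma> by (intro mult_left_mono) auto
    then have "x - \<sigma> \<le> x * ln (x / \<sigma>)"
      using \<sigma> by (simp add: right_diff_distrib)
    then have "(x - \<sigma>) / (1 - x) \<le> y"
      unfolding y_def using x4 by (intro divide_right_mono) auto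
    moreover have "(x - \<sigma>) / (1 - x) - (x - \<sigma>) / (1 - \<sigma>) = (x - \<sigma>)\<^sup>2 / ((1 - x) * (1 - \<sigma>))"
      using x4 \<sigma>4 by (simp add: divide_simps power2_eq_square) (simp add: algebra_simps)
    moreover have "0 \<le> (x - \<sigma>)\<^sup>2 / ((1 - x) * (1 - \<sigma>))"
      using x4 \<sigma>4 by simp
    ultimately show ?thesis unfolding D_def by linarith
  qed
  have j\<sigma>: "real j * \<sigma> \<le> 1 / 4" if "j \<le> m" for j
    using mult_right_mono[of "real j" "real m" \<sigma>] that \<sigma> by linarith
  have g: "1 / 2 \<le> g j" if "j \<le> m" for j
    using j\<sigma>[OF that] \<sigma>4 by (simp add: g_def algebra_simps)
  \<comment> \<open>Multiplying the bounds and AM-GM both need nonnegativity. Here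
    \<open>1 - x \<ge> 3/4\<close>, and \<open>real j * \<tau> \<le> 3/4\<close> because
    \<open>D \<ge> 0\<close> gives \<open>- y \<le> 1\<close>.\<close>
  have f0: "0 \<le> 1 - x - real j * \<tau>" if "j \<le> m" for j
  proof -
    have "- y \<le> (\<sigma> - x) / (1 - \<sigma>)" using D0 by (simp add: D_def diff_divide_distrib)
    also have "\<dots> \<le> 1" using \<sigma>4 x by simp
    finally have "exp (- y) \<le> 3" using exp_le exp_le_cancel_iff by (meson order_trans)
    then have "real j * \<sigma> * exp (- y) \<le> 1 / 4 * 3"
      using j\<sigma>[OF that] by (intro mult_mono) auto
    then show ?thesis using x4 by (simp add: \<tau>_def y_def mult.assoc)
  qed
  have fga: "1 - x - real j * \<tau> \<le> g j * a j" if "j \<le> m" for j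
  proof -
    have "1 - y \<le> exp (- y)" using exp_ge_add_one_self[of "- y"] by simp
    then have "real j * \<sigma> * (1 - y) \<le> real j * \<sigma> * exp (- y)"
      using \<sigma> by (intro mult_left_mono) auto
    then have "1 - x - real j * \<tau> \<le> 1 - x - real j * \<sigma> * (1 - y)"
      by (simp add: \<tau>_def y_def mult.assoc)
    also have "\<dots> = g j * (1 + (\<sigma> - x) / (1 - \<sigma>)) + real j * \<sigma> * D"
      using \<sigma>4 unfolding g_def D_def by (simp add: divide_simps) (simp add: algebra_simps)
    also have "real j * \<sigma> * D \<le> g j * (2 * real j * \<sigma> * D)"
      using mult_right_mono[OF g[OF that], of "2 * real j * \<sigma> * D"] \<sigma> D0 by simp
    finally show ?thesis by (simp add: a_def algebra_simps)
  qed
  have gpos: "0 < (\<Prod>j\<le>m. g j)"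
    using g by (intro prod_pos) (force intro: less_le_trans[of 0 "1/2"])
  have a0: "0 \<le> a j" if "j \<le> m" for j
  proof (rule ccontr)
    assume "\<not> 0 \<le> a j"
    then have "g j * a j < 0" using g[OF that] by (intro mult_pos_neg) auto
    then show False using f0[OF that] fga[OF that] by linarith
  qed
  have "(\<Sum>j\<le>m. a j) = (\<Sum>j\<le>m. 1 + (\<sigma> - x) / (1 - \<sigma>)) + (\<Sum>j\<le>m. real j * (2 * \<sigma> * D))"
    unfolding sum.distrib[symmetric] by (simp add: a_def mult_ac)
  also have "\<dots> = (real m + 1) * (1 + (\<sigma> - x) / (1 - \<sigma>)) + (2 * (\<Sum>j\<le>m. real j)) * (\<sigma> * D)"
    unfolding sum_distrib_right[symmetric] by (simp add: mult_ac add.commute)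
  also have "2 * (\<Sum>j\<le>m. real j) = real m * (real m + 1)"
    by (induction m) (auto simp: algebra_simps)
  finally have sum_a: "(\<Sum>j\<le>m. a j) / (real m + 1) = 1 + ((\<sigma> - x) / (1 - \<sigma>) + real m * \<sigma> * D)"
    by (simp add: add_divide_distrib)
  have "(\<Prod>j\<le>m. a j) \<le> ((\<Sum>j\<le>m. a j) / (real m + 1)) ^ (m + 1)"
    using prod_le_power_mean[of "{..m}" a] a0 by (simp add: add.commute)
  then have mean: "(\<Prod>j\<le>m. a j) \<le> (1 + ((\<sigma> - x) / (1 - \<sigma>) + real m * \<sigma> * D)) ^ (m + 1)"
    unfolding sum_a .
  have "?L \<le> (\<Prod>j\<le>m. g j * a j)"
    using f0 fga by (intro prod_mono) auto
  also have "\<dots> = (\<Prod>j\<le>m. g j) * (\<Prod>j\<le>m. a j)"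
    by (rule prod.distrib)
  also have "\<dots> \<le> (\<Prod>j\<le>m. g j) * (1 + ((\<sigma> - x) / (1 - \<sigma>) + real m * \<sigma> * D)) ^ (m + 1)"
    using mean gpos by (intro mult_left_mono) auto
  finally have le: "?L \<le> (\<Prod>j\<le>m. g j) * (1 + ((\<sigma> - x) / (1 - \<sigma>) + real m * \<sigma> * D)) ^ (m + 1)" .
  show strict: "?L < ?R" if "x \<noteq> \<sigma>"
    using le_less_trans[OF le mult_strict_left_mono[OF power_lt_linear_log[OF m \<sigma> x that] gpos,
          folded y_def, folded D_def]]
    by (simp add: g_def)
  show "?L \<le> ?R"
  proof (cases "x = \<sigma>")
    case True
    then show ?thesis using \<sigma> by (simp add: \<tau>_def algebra_simps)
  qed (use strict in auto)
qed

text \<open>Homogeneity: passing to \<open>x / s\<close> and \<open>T / s\<close> takes a factor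
  \<open>s ^ (m + 1)\<close> out of both sides.\<close>

lemma prod_scaled_le:
  fixes x s T :: real and m :: nat
  defines "\<tau> \<equiv> T * exp (- (x * ln (x / T) / (s - x)))"
  assumes s: "0 < s" and m: "1 \<le> m" and T: "0 < T" "4 * real m * T \<le> s" and x: "0 < x" "4 * real m * x \<le> s"
  shows "(\<Prod>j\<le>m. s - x - real j * \<tau>)
      \<le> (\<Prod>j\<le>m. s - (real j + 1) * T) * (1 - (real m + 1) * T / (s - T) * ln (x / T))"
    and "x \<noteq> T \<Longrightarrow> (\<Prod>j\<le>m. s - x - real j * \<tau>)
      < (\<Prod>j\<le>m. s - (real j + 1) * T) * (1 - (real m + 1) * T / (s - T) * ln (x / T))"
proof -
  define \<tau>' where "\<tau>' = T / s * exp (- (x / s * ln (x / s / (T / s)) / (1 - x / s)))"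
  have hyps: "0 < T / s" "4 * real m * (T / s) \<le> 1" "0 < x / s" "4 * real m * (x / s) \<le> 1"
    using s T x by (simp_all add: field_simps)
  have "\<tau> = s * \<tau>'"
    using s by (simp add: \<tau>_def \<tau>'_def right_diff_distrib)
  then have "s - x - real j * \<tau> = s * (1 - x / s - real j * \<tau>')" for j
    using s by (simp add: right_diff_distrib)
  then have L: "(\<Prod>j\<le>m. s - x - real j * \<tau>) = s ^ (m + 1) * (\<Prod>j\<le>m. 1 - x / s - real j * \<tau>')"
    by (simp add: prod.distrib)
  have "s - (real j + 1) * T = s * (1 - (real j + 1) * (T / s))" for j
    using s by (simp add: right_diff_distrib)
  then have R: "(\<Prod>j\<le>m. s - (real j + 1) * T) = s ^ (m + 1) * (\<Prod>j\<le>m. 1 - (real j + 1) * (T / s))"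
    by (simp add: prod.distrib)
  have E: "(real m + 1) * T / (s - T) * ln (x / T)
      = (real m + 1) * (T / s) * ln (x / s / (T / s)) / (1 - T / s)"
    using s by (simp add: diff_divide_distrib[symmetric] divide_simps)
  note norm = prod_normalised_le[OF m hyps, folded \<tau>'_def]
  show "(\<Prod>j\<le>m. s - x - real j * \<tau>)
      \<le> (\<Prod>j\<le>m. s - (real j + 1) * T) * (1 - (real m + 1) * T / (s - T) * ln (x / T))"
    unfolding L R E mult.assoc[of "s ^ (m + 1)"] using norm(1) s by (intro mult_left_mono) auto
  show "(\<Prod>j\<le>m. s - x - real j * \<tau>)
      < (\<Prod>j\<le>m. s - (real j + 1) * T) * (1 - (real m + 1) * T / (s - T) * ln (x / T))" if "x \<noteq> T"
    unfolding L R E mult.assoc[of "s ^ (m + 1)"] using norm(2) that s by (intro mult_strict_left_mono) auto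
qed

section \<open>Symmetric sums, weighted geometric means, and the induction on the degree\<close>

definition esym :: "'a set \<Rightarrow> nat \<Rightarrow> ('a \<Rightarrow> real) \<Rightarrow> real" where
  "esym A k x = (\<Sum>I\<in>{I. I \<subseteq> A \<and> card I = k}. \<Prod>i\<in>I. x i)"

text \<open>Double counting of the pairs \<open>(I, i)\<close> with \<open>i \<in> I\<close> and
  \<open>card I = Suc k\<close>, each weighted by \<open>prod x I\<close>.\<close>

lemma esym_Suc:
  assumes "finite A"
  shows "real (Suc k) * esym A (Suc k) x = (\<Sum>i\<in>A. x i * esym (A - {i}) k x)"
proof -
  let ?S = "\<lambda>A k. {I. I \<subseteq> A \<and> card I = k}"
  have fin: "finite I" if "I \<subseteq> A" for I
    using that assms finite_subset by blast
  have fS: "finite (?S B k)" if "B \<subseteq> A" for B k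
    using fin[OF that] by simp
  have "(\<Sum>i\<in>A. x i * esym (A - {i}) k x) = (\<Sum>i\<in>A. \<Sum>J\<in>?S (A - {i}) k. x i * prod x J)"
    by (simp add: esym_def sum_distrib_left)
  also have "\<dots> = (\<Sum>(i, J)\<in>Sigma A (\<lambda>i. ?S (A - {i}) k). x i * prod x J)"
    using assms fS by (intro sum.Sigma) auto
  also have "\<dots> = (\<Sum>(I, i)\<in>Sigma (?S A (Suc k)) (\<lambda>I. I). prod x I)"
    by (rule sum.reindex_bij_witness[of _ "\<lambda>(I, i). (i, I - {i})" "\<lambda>(i, J). (insert i J, i)"])
      (auto simp: fin insert_absorb subset_Diff_insert dest: fin)
  also have "\<dots> = (\<Sum>I\<in>?S A (Suc k). \<Sum>i\<in>I. prod x I)"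
    using fin fS[OF order_refl] by (intro sum.Sigma[symmetric]) auto
  also have "\<dots> = real (Suc k) * esym A (Suc k) x"
    by (simp add: esym_def sum_distrib_left)
  finally show ?thesis ..
qed

lemma esym_0:
  assumes "finite A"
  shows "esym A 0 x = 1"
proof -
  have "{I. I \<subseteq> A \<and> card I = 0} = {{}}"
    using assms finite_subset by (auto simp: card_eq_0_iff)
  then show ?thesis by (simp add: esym_def)
qed

lemma esym_1:
  assumes "finite A"
  shows "esym A (Suc 0) x = sum x A"
  using esym_Suc[OF assms, of 0 x] assms by (simp add: esym_0)

lemma esym_2:
  assumes "finite A"
  shows "2 * esym A (Suc (Suc 0)) x = (sum x A)\<^sup>2 - (\<Sum>i\<in>A. (x i)\<^sup>2)"
  using esym_Suc[OF assms, of "Suc 0" x] assms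
  by (simp add: esym_1 sum_diff1 right_diff_distrib sum_subtractf power2_eq_square flip: sum_distrib_right)

text \<open>The entries serve as their own weights. Division by the sum makes this homogeneous of
  degree one on positive families.\<close>

definition wgmean :: "'a set \<Rightarrow> ('a \<Rightarrow> real) \<Rightarrow> real" where
  "wgmean A x = exp ((\<Sum>i\<in>A. x i * ln (x i)) / sum x A)"

context
  fixes A :: "'a set" and x :: "'a \<Rightarrow> real"
  assumes fin: "finite A" and ne: "A \<noteq> {}" and pos: "\<And>i. i \<in> A \<Longrightarrow> 0 < x i"
begin

lemma sum_pos_A: "0 < sum x A"
  using fin ne pos by (rule sum_pos)

lemma sum_ln_ratio_eq_0: "(\<Sum>i\<in>A. x i * ln (x i / wgmean A x)) = 0"
proof -
  have "(\<Sum>i\<in>A. x i * ln (x i / wgmean A x)) = (\<Sum>i\<in>A. x i * ln (x i)) - sum x A * ln (wgmean A x)"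
    unfolding sum_distrib_right sum_subtractf[symmetric]
  proof (rule sum.cong)
    fix i assume "i \<in> A"
    from pos[OF this] show "x i * ln (x i / wgmean A x) = x i * ln (x i) - x i * ln (wgmean A x)"
      by (simp add: wgmean_def ln_div right_diff_distrib)
  qed simp
  then show ?thesis using sum_pos_A by (simp add: wgmean_def)
qed

lemma wgmean_le:
  assumes "\<And>i. i \<in> A \<Longrightarrow> x i \<le> c"
  shows "wgmean A x \<le> c"
proof -
  have c: "0 < c" using assms pos ne by (meson all_not_in_conv less_le_trans)
  have "(\<Sum>i\<in>A. x i * ln (x i)) \<le> (\<Sum>i\<in>A. x i * ln c)"
    using assms pos c by (intro sum_mono mult_left_mono) (auto simp: less_imp_le)
  then have "(\<Sum>i\<in>A. x i * ln (x i)) / sum x A \<le> ln c"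
    using sum_pos_A by (simp add: pos_divide_le_eq mult.commute[of "ln c"] sum_distrib_right)
  then show ?thesis using c by (simp add: wgmean_def ln_ge_iff)
qed

text \<open>\<open>ln t \<le> t - 1\<close> at the ratios \<open>t = x i / wgmean A x\<close>.
  Together with \<open>esym_2\<close> this is the base case \<open>k = 2\<close>.\<close>

lemma sum_mult_wgmean_le: "sum x A * wgmean A x \<le> (\<Sum>i\<in>A. (x i)\<^sup>2)"
proof -
  let ?T = "wgmean A x"
  have T: "0 < ?T" by (simp add: wgmean_def)
  have "0 \<le> (\<Sum>i\<in>A. x i * (x i / ?T - 1))"
    unfolding sum_ln_ratio_eq_0[symmetric]
    using pos T by (intro sum_mono mult_left_mono ln_le_minus_one) (auto simp: less_imp_le)
  also have "\<dots> = (\<Sum>i\<in>A. (x i)\<^sup>2) / ?T - sum x A"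
    by (simp add: right_diff_distrib sum_subtractf sum_divide_distrib power2_eq_square)
  finally show ?thesis using T by (simp add: field_simps)
qed

text \<open>Identifies the new mean with the \<open>\<tau>\<close> of \<open>prod_scaled_le\<close>,
  so that a one-variable bound applies to each removed entry.\<close>

lemma wgmean_remove:
  assumes "i \<in> A" "x i < sum x A"
  shows "wgmean (A - {i}) x
    = wgmean A x * exp (- (x i * ln (x i / wgmean A x) / (sum x A - x i)))"
proof -
  let ?h = "\<Sum>i\<in>A. x i * ln (x i)"
  have "(?h - x i * ln (x i)) / (sum x A - x i)
      = ?h / sum x A - x i * (ln (x i) - ?h / sum x A) / (sum x A - x i)"
    using assms sum_pos_A by (simp add: divide_simps) (simp add: algebra_simps)
  then show ?thesis
    using assms fin pos by (simp add: wgmean_def sum_diff1 ln_div flip: exp_add)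
qed

end

text \<open>Here \<open>k = m + 2\<close>, so the bound on the entries says nothing new in the base
  case. The step uses only the weak inequality from the induction hypothesis; strictness comes from
  the tangent line at an entry other than the mean.\<close>

lemma fact_esym_le:
  fixes A :: "'a set" and x :: "'a \<Rightarrow> real"
  assumes "finite A" "A \<noteq> {}" "\<And>i. i \<in> A \<Longrightarrow> 0 < x i"
    and "\<And>i. i \<in> A \<Longrightarrow> 4 * real m * x i \<le> sum x A"
  shows "fact (m + 2) * esym A (m + 2) x \<le> sum x A * (\<Prod>j\<le>m. sum x A - (real j + 1) * wgmean A x)
    \<and> (1 \<le> m \<longrightarrow> (\<exists>i\<in>A. x i \<noteq> wgmean A x) \<longrightarrow>
      fact (m + 2) * esym A (m + 2) x < sum x A * (\<Prod>j\<le>m. sum x A - (real j + 1) * wgmean A x))"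
  using assms
proof (induction m arbitrary: A)
  case 0
  then show ?case
    using esym_2[of A x] sum_mult_wgmean_le[of A x]
    by (simp add: power2_eq_square right_diff_distrib numeral_2_eq_2)
next
  case (Suc m)
  let ?s = "sum x A" and ?T = "wgmean A x" and ?M = "real (Suc m)"
  define P where "P = (\<Prod>j\<le>Suc m. ?s - (real j + 1) * ?T)"
  define F where "F i = (\<Prod>j\<le>Suc m. ?s - x i - real j * wgmean (A - {i}) x)" for i
  define G where "G i = P * (1 - (?M + 1) * ?T / (?s - ?T) * ln (x i / ?T))" for i
  have s: "0 < ?s" using Suc.prems by (simp add: sum_pos)
  have xs: "4 * x i \<le> ?s" "x i < ?s" if "i \<in> A" for i
    using Suc.prems(3,4)[OF that] mult_right_mono[of 1 ?M "x i"] by linarith+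
  have T: "0 < ?T" "4 * ?M * ?T \<le> ?s"
  proof -
    have "?T \<le> ?s / (4 * ?M)"
      using Suc.prems by (intro wgmean_le) (auto simp: field_simps)
    then show "4 * ?M * ?T \<le> ?s" by (simp add: field_simps)
  qed (simp add: wgmean_def)
  have IH: "fact (m + 2) * esym (A - {i}) (m + 2) x \<le> F i" if i: "i \<in> A" for i
  proof -
    have sumi: "sum x (A - {i}) = ?s - x i"
      using i Suc.prems(1) by (simp add: sum_diff1)
    have "A - {i} \<noteq> {}" using sumi xs[OF i] by force
    moreover have "4 * real m * x j \<le> sum x (A - {i})" if j: "j \<in> A - {i}" for j
    proof -
      \<comment> \<open>The inherited bound, multiplied by \<open>m + 1\<close>:
        \<open>m * s \<le> (m + 1) * (s - x i)\<close> amounts to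
        \<open>(m + 1) * x i \<le> s\<close>.\<close>
      have "?M * (4 * real m * x j) \<le> real m * ?s"
        using mult_left_mono[OF Suc.prems(4)[of j], of "real m"] j by (simp add: algebra_simps)
      also have "\<dots> \<le> ?M * (?s - x i)"
      proof -
        have "0 < ?M * x i" using Suc.prems(3)[OF i] by simp
        then have "?M * x i \<le> ?s" using Suc.prems(4)[OF i] by linarith
        then show ?thesis by (simp add: algebra_simps)
      qed
      finally show ?thesis by (simp add: sumi)
    qed
    ultimately have "fact (m + 2) * esym (A - {i}) (m + 2) x \<le> sum x (A - {i}) * (\<Prod>j\<le>m. sum x (A - {i}) - (real j + 1) * wgmean (A - {i}) x)"
      using Suc.IH[of "A - {i}"] Suc.prems by auto
    also have "\<dots> = F i"
      \<comment> \<open>The factor \<open>j = 0\<close> of \<open>F i\<close> is the sum of the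
        reduced family; the other indices shift by one.\<close>
      unfolding F_def sumi prod.atMost_Suc_shift by (simp add: add.commute)
    finally show ?thesis .
  qed
  have FG: "F i \<le> G i" "x i \<noteq> ?T \<Longrightarrow> F i < G i" if i: "i \<in> A" for i
    using prod_scaled_le[of ?s "Suc m" ?T "x i"] s T xs[OF i] Suc.prems(3,4)[OF i]
      wgmean_remove[OF Suc.prems(1-3) i xs(2)[OF i]]
    by (simp_all add: F_def G_def P_def)
  have "(\<Sum>i\<in>A. x i * G i) = P * (?s - (?M + 1) * ?T / (?s - ?T) * (\<Sum>i\<in>A. x i * ln (x i / ?T)))"
  proof -
    have eq: "x i * G i = P * x i - P * ((?M + 1) * ?T / (?s - ?T)) * (x i * ln (x i / ?T))" for i
      unfolding G_def by (simp add: right_diff_distrib mult_ac)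
    show ?thesis
      unfolding eq sum_subtractf sum_distrib_left[symmetric] by (simp add: right_diff_distrib)
  qed
  then have sumG: "(\<Sum>i\<in>A. x i * G i) = ?s * P"
    using sum_ln_ratio_eq_0[OF Suc.prems(1-3)] by simp
  have "fact (Suc m + 2) * esym A (Suc m + 2) x = fact (m + 2) * (real (Suc (m + 2)) * esym A (Suc (m + 2)) x)"
    by simp
  also have "\<dots> = (\<Sum>i\<in>A. x i * (fact (m + 2) * esym (A - {i}) (m + 2) x))"
    unfolding esym_Suc[OF Suc.prems(1)] by (simp add: sum_distrib_left mult_ac)
  also have "\<dots> \<le> (\<Sum>i\<in>A. x i * F i)"
    using IH Suc.prems(3) by (intro sum_mono mult_left_mono) (auto simp: less_imp_le)
  finally have le: "fact (Suc m + 2) * esym A (Suc m + 2) x \<le> (\<Sum>i\<in>A. x i * F i)" .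
  have "(\<Sum>i\<in>A. x i * F i) \<le> (\<Sum>i\<in>A. x i * G i)"
    using FG Suc.prems(3) by (intro sum_mono mult_left_mono) (auto simp: less_imp_le)
  moreover have "(\<Sum>i\<in>A. x i * F i) < (\<Sum>i\<in>A. x i * G i)" if "\<exists>i\<in>A. x i \<noteq> ?T"
  proof (rule sum_strict_mono_ex1)
    show "\<forall>i\<in>A. x i * F i \<le> x i * G i"
      using FG Suc.prems(3) by (auto intro!: mult_left_mono simp: less_imp_le)
    show "\<exists>i\<in>A. x i * F i < x i * G i"
      using that FG(2) Suc.prems(3) by (meson mult_strict_left_mono)
  qed (use Suc.prems in auto)
  ultimately show ?case
    using le unfolding sumG P_def by (meson le_less_trans order_trans)
qed

section \<open>Return to the simplex by restriction to the nonzero entries\<close>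

lemma sigma_ent_eq_wgmean:
  assumes "x \<in> simplex n"
  shows "sigma_ent n x = wgmean {i. i < n \<and> x i \<noteq> 0} x"
proof -
  let ?A = "{i. i < n \<and> x i \<noteq> 0}"
  have "sum x ?A = sum x {..<n}"
    by (rule sum.mono_neutral_left) auto
  then have sum1: "sum x ?A = 1" using assms by (simp add: simplex_def)
  have "sigma_ent n x = (\<Prod>i\<in>?A. if x i = 0 then 1 else x i powr x i)"
    unfolding sigma_ent_def by (rule prod.mono_neutral_right) auto
  also have "\<dots> = (\<Prod>i\<in>?A. exp (x i * ln (x i)))"
    by (rule prod.cong) (auto simp: powr_def)
  also have "\<dots> = wgmean ?A x"
    by (simp add: wgmean_def sum1 exp_sum)
  finally show ?thesis .
qed

lemma elem_sym_eq_esym: "elem_sym n k x = esym {i. i < n \<and> x i \<noteq> 0} k x"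
  unfolding elem_sym_def esym_def
proof (rule sum.mono_neutral_right)
  show "\<forall>I\<in>{I. I \<subseteq> {..<n} \<and> card I = k} - {I. I \<subseteq> {i. i < n \<and> x i \<noteq> 0} \<and> card I = k}. prod x I = 0"
    using finite_subset[OF _ finite_lessThan[of n]] by (force simp: subset_iff)
qed auto

theorem theorem2:
  fixes n k :: nat and x :: "nat \<Rightarrow> real"
  assumes "k \<ge> 3"
    and "x \<in> simplex n"
    and "max_norm n x \<le> 1 / (4 * (real k - 2))"
    and "\<not> (\<forall>i<n. \<forall>j<n. x i \<noteq> 0 \<and> x j \<noteq> 0 \<longrightarrow> x i = x j)"
  shows "elem_sym n k x < (sigma_ent n x) ^ k * ((1 / sigma_ent n x) gchoose k)"
proof -
  define A where "A = {i. i < n \<and> x i \<noteq> 0}"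
  define m where "m = k - 2"
  define \<sigma> where "\<sigma> = sigma_ent n x"
  have k: "k = m + 2" "1 \<le> m" using assms(1) by (auto simp: m_def)
  have \<sigma>: "\<sigma> = wgmean A x"
    using sigma_ent_eq_wgmean[OF assms(2)] by (simp add: \<sigma>_def A_def)
  have \<sigma>0: "0 < \<sigma>" by (simp add: \<sigma> wgmean_def)
  have fin: "finite A" by (simp add: A_def)
  have "sum x A = sum x {..<n}"
    unfolding A_def by (rule sum.mono_neutral_left) auto
  then have sum1: "sum x A = 1" using assms(2) by (simp add: simplex_def)
  then have ne: "A \<noteq> {}" by auto
  have pos: "0 < x i" if "i \<in> A" for i
    using that assms(2) by (force simp: A_def simplex_def less_le)
  have le: "4 * real m * x i \<le> sum x A" if "i \<in> A" for i
  proof -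
    have "x i \<le> max_norm n x"
      unfolding max_norm_def using that by (intro Max_ge) (auto simp: A_def)
    also have "\<dots> \<le> 1 / (4 * real m)" using assms(3) by (simp add: k)
    finally show ?thesis using k sum1 by (simp add: field_simps)
  qed
  \<comment> \<open>Otherwise all nonzero entries would equal the mean, hence each other.\<close>
  have "\<exists>i\<in>A. x i \<noteq> wgmean A x"
    using assms(4) unfolding A_def by (metis (mono_tags, lifting) mem_Collect_eq)
  then have "fact k * elem_sym n k x < (\<Prod>j\<le>m. 1 - (real j + 1) * \<sigma>)"
    using fact_esym_le[OF fin ne pos le] k(2) unfolding k(1) elem_sym_eq_esym A_def[symmetric] sum1 \<sigma> by simp
  \<comment> \<open>The added factor \<open>j = 0\<close> is 1.\<close>
  also have "\<dots> = (\<Prod>j<k. 1 - real j * \<sigma>)"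
    
    using prod.lessThan_Suc_shift[of "\<lambda>j. 1 - real j * \<sigma>" "Suc m"]
    by (simp add: k(1) lessThan_Suc_atMost add.commute del: prod.lessThan_Suc)
  also have "\<dots> = \<sigma> ^ k * (\<Prod>j<k. 1 / \<sigma> - real j)"
  proof -
    have "1 - real j * \<sigma> = \<sigma> * (1 / \<sigma> - real j)" for j
      using \<sigma>0 by (simp add: right_diff_distrib)
    then show ?thesis by (simp add: prod.distrib)
  qed
  also have "\<dots> = fact k * (\<sigma> ^ k * ((1 / \<sigma>) gchoose k))"
    by (simp add: gbinomial_mult_fact atLeast0LessThan mult.left_commute)
  finally show ?thesis by (simp add: \<sigma>_def)
qed

end
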